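(* Let $f:\mathbb{Z}_N\to\mathbb{C}$ be nonzero and fix $\eta>0$. Define the large spectrum $$\Gamma:=\left\{m\in\mathbb{Z}_N : |\widehat f(m)|\ge\eta\,\|f\|_{L^2(\mu)}\right\}.$$ Then $$|\Gamma|\le\frac{\mathrm{FR}(f)}{\eta}\sqrt N,$$ and moreover if $$P(x):=\frac{1}{N^{1/2}}\sum_{m\in\Gamma}\widehat f(m)\chi(xm),$$ then $$\|f-P\|_2\le\eta\,\|f\|_2 .$$ In other words, $f$ can be approximated by a trigonometric polynomial of degree (number of frequencies) at most $\frac{\mathrm{FR}(f)}{\eta}\sqrt N$ up to a relative $L^2$ error $\le\eta$.
   Context: $N$ is a positive integer, $\mathbb{Z}_N=\mathbb{Z}/N\mathbb{Z}$, $\chi(t)=e^{2\pi i t/N}$. For $f:\mathbb{Z}_N\to\mathbb{C}$ the unitary Fourier transform is $\widehat f(m)=N^{-1/2}\sum_{x\in\mathbb{Z}_N}\chi(-xm)f(x)$. $\|g\|_p=\left(\sum_{x\in\mathbb{Z}_N}|g(x)|^p\right)^{1/p}$ and $\|g\|_{L^2(\mu)}=N^{-1/2}\|g\|_2$. The Fourier ratio of a nonzero $f$ is $\mathrm{FR}(f)=\|\widehat f\|_1/\|\widehat f\|_2$. *)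

theory Defs
  imports "HOL-Analysis.Analysis" "Berlekamp_Zassenhaus.Finite_Field"
begin

text \<open>
  The ring $\mathbf{Z}/N\mathbf{Z}$ is the type \<open>'n mod_ring\<close>, whose modulus is $N =$ \<open>CARD('n)\<close>.
  Only \<open>'n :: finite\<close> is required, so $N$ ranges over all positive integers, including $N = 1$.
\<close>

text \<open>
  The character $t \mapsto e^{2 \pi i t / N}$, evaluated at the representative of \<open>t\<close>
  in $\{0, \ldots, N-1\}$.
\<close>
definition chi :: "'n::finite mod_ring \<Rightarrow> complex" where
  "chi t = exp (2 * of_real pi * \<i> * of_int (to_int_mod_ring t) / of_nat CARD('n))"

definition fourier :: "('n::finite mod_ring \<Rightarrow> complex) \<Rightarrow> 'n mod_ring \<Rightarrow> complex" where
  "fourier f m = 1 / of_real (sqrt (real CARD('n))) * (\<Sum>x\<in>UNIV. chi (- (x * m)) * f x)"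

definition lp_norm :: "real \<Rightarrow> ('n::finite mod_ring \<Rightarrow> complex) \<Rightarrow> real" where
  "lp_norm p g = (\<Sum>x\<in>UNIV. cmod (g x) powr p) powr (1 / p)"

definition L2mu_norm :: "('n::finite mod_ring \<Rightarrow> complex) \<Rightarrow> real" where
  "L2mu_norm g = 1 / sqrt (real CARD('n)) * lp_norm 2 g"

definition fourier_ratio :: "('n::finite mod_ring \<Rightarrow> complex) \<Rightarrow> real" where
  "fourier_ratio f = lp_norm 1 (fourier f) / lp_norm 2 (fourier f)"

definition large_spectrum ::
    "real \<Rightarrow> ('n::finite mod_ring \<Rightarrow> complex) \<Rightarrow> 'n mod_ring set" where
  "large_spectrum \<eta> f = {m. cmod (fourier f m) \<ge> \<eta> * L2mu_norm f}"

text \<open>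
  The trigonometric polynomial with frequencies in \<open>S\<close> and coefficients \<open>c\<close>; its degree is
  the number of frequencies, \<open>card S\<close>.
\<close>
definition trig_poly ::
    "'n::finite mod_ring set \<Rightarrow> ('n mod_ring \<Rightarrow> complex) \<Rightarrow> 'n mod_ring \<Rightarrow> complex" where
  "trig_poly S c x = (\<Sum>m\<in>S. c m * chi (x * m))"

end

theory Submission
  imports Defs
begin

text \<open>
  Orthogonality of the characters gives Fourier inversion and Plancherel. By inversion,
  $f - P$ is the synthesis of the Fourier coefficients outside $\Gamma$, so by Plancherel its
  squared norm is the sum over at most $N$ coefficients of squares below
  $\eta^2 \|f\|_2^2 / N$. The bound on $|\Gamma|$ is Markov's inequality for
  $\|\widehat f\|_1 = \mathrm{FR}(f)\,\|f\|_2$.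
\<close>

text \<open>\<open>k\<close> and \<open>k mod int N\<close> differ by a multiple of
  \<open>N\<close>, which moves the exponent by a multiple of 2 pi i. Since \<open>chi\<close> works
  on representatives, this is what makes it additive despite the reduction in
  \<open>a + b\<close>.\<close>

lemma exp_mod_period:
  assumes "N > 0"
  shows "exp (2 * of_real pi * \<i> * of_int (k mod int N) / of_nat N)
    = exp (2 * of_real pi * \<i> * of_int k / of_nat N)"
proof -
  have k: "of_int k = of_int (k mod int N) + (of_nat N :: complex) * of_int (k div int N)"
    by (metis mod_mult_div_eq of_int_add of_int_mult of_int_of_nat_eq)
  have "2 * of_real pi * \<i> * of_int k / of_nat N
    = 2 * of_real pi * \<i> * of_int (k mod int N) / of_nat N
      + (2 * of_int (k div int N) * of_real pi) * \<i>"
    unfolding k using assms by (simp add: field_simps)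
  moreover have "exp ((2 * of_int (k div int N) * of_real pi) * \<i>) = 1"
    unfolding exp_eq_1 by auto
  ultimately show ?thesis
    by (simp only: exp_add mult_1_right)
qed

lemma to_int_mod_ring_add:
  "to_int_mod_ring (a + b :: 'n::finite mod_ring)
    = (to_int_mod_ring a + to_int_mod_ring b) mod int CARD('n)"
  by transfer simp

lemma chi_add: "chi (a + b) = chi a * chi (b :: 'n::finite mod_ring)"
  unfolding chi_def to_int_mod_ring_add exp_mod_period[OF zero_less_card_finite]
  by (simp add: exp_add[symmetric] add_divide_distrib[symmetric] distrib_left)

lemma chi_diff_mult: "chi ((x - y) * z) = chi (x * z) * chi (- (y * z))"
  by (simp add: left_diff_distrib flip: chi_add)

lemma chi_0 [simp]: "chi 0 = 1"
  by (simp add: chi_def)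

lemma norm_chi [simp]: "cmod (chi x) = 1"
  by (simp add: chi_def norm_exp_eq_Re)

text \<open>Both sides are inverses of \<open>chi x\<close>: one by additivity, the other because
  \<open>chi x\<close> has modulus 1.\<close>

lemma cnj_chi: "cnj (chi x) = chi (- x)"
proof -
  have "chi x * chi (- x) = 1"
    by (simp flip: chi_add)
  moreover have "chi x * cnj (chi x) = 1"
    by (simp add: complex_norm_square[symmetric])
  ultimately show ?thesis
    by (metis mult_cancel_left mult_zero_left zero_neq_one)
qed

lemma chi_eq_1_iff: "chi (x :: 'n::finite mod_ring) = 1 \<longleftrightarrow> x = 0"
proof
  assume "chi x = 1"
  let ?k = "to_int_mod_ring x"
  have k: "0 \<le> ?k" "?k < int CARD('n)"
    using range_to_int_mod_ring[where 'a = 'n] by auto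
  from \<open>chi x = 1\<close> obtain n :: int
    where "2 * pi * of_int ?k / CARD('n) = of_int (2 * n) * pi"
    unfolding chi_def exp_eq_1 by auto
  then have "real_of_int ?k = of_int (n * int CARD('n))"
    by (simp add: field_simps)
  then have "?k = n * int CARD('n)"
    by linarith
  \<comment> \<open>The only multiple of N in the range 0, ..., N - 1 is 0.\<close>
  with k have "?k = 0"
    by (metis mod_mult_self2_is_0 mod_pos_pos_trivial)
  then show "x = 0"
    by simp
qed simp

text \<open>Without the class \<open>nontriv\<close> the type has no constant \<open>1\<close>.\<close>

lemma mult_of_int_mod_ring_1: "(x :: 'n::finite mod_ring) * of_int_mod_ring 1 = x"
  by transfer (simp add: mod_simps)

text \<open>Translating \<open>m\<close> by the residue of 1 permutes the summands but multiplies
  the sum by \<open>chi x\<close>, which differs from 1 unless \<open>x = 0\<close>.\<close>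

lemma chi_orthogonality:
  fixes x :: "'n::finite mod_ring"
  shows "(\<Sum>m\<in>UNIV. chi (x * m)) = (if x = 0 then of_nat CARD('n) else 0)"
proof (cases "x = 0")
  case False
  let ?S = "\<Sum>m\<in>UNIV. chi (x * m)"
  have "?S = (\<Sum>m\<in>UNIV. chi (x * (m + of_int_mod_ring 1)))"
    by (rule sum.reindex_bij_witness
        [of _ "\<lambda>m. m + of_int_mod_ring 1" "\<lambda>m. m - of_int_mod_ring 1"]) auto
  also have "\<dots> = chi x * ?S"
    by (simp add: distrib_left chi_add mult_of_int_mod_ring_1 sum_distrib_left mult.commute)
  finally show ?thesis
    using False by (simp add: chi_eq_1_iff)
qed simp

lemma fourier_inversion:
  fixes f :: "'n::finite mod_ring \<Rightarrow> complex"
  shows "1 / of_real (sqrt (real CARD('n))) * (\<Sum>m\<in>UNIV. fourier f m * chi (x * m)) = f x"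
proof -
  let ?s = "complex_of_real (sqrt (real CARD('n)))"
  have s: "?s * ?s = of_nat CARD('n)"
    by (simp flip: of_real_mult)
  have "(\<Sum>m\<in>UNIV. fourier f m * chi (x * m))
      = (\<Sum>m\<in>UNIV. \<Sum>y\<in>UNIV. f y * chi ((x - y) * m) / ?s)"
    unfolding fourier_def chi_diff_mult
    by (simp add: sum_distrib_left sum_distrib_right sum_divide_distrib mult_ac)
  \<comment> \<open>With the sum over \<open>m\<close> innermost, orthogonality leaves only
    \<open>y = x\<close>.\<close>
  also have "\<dots> = (\<Sum>y\<in>UNIV. f y * (\<Sum>m\<in>UNIV. chi ((x - y) * m)) / ?s)"
    by (subst sum.swap) (simp add: sum_distrib_left sum_divide_distrib)
  also have "\<dots> = f x * of_nat CARD('n) / ?s"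
    unfolding chi_orthogonality by (simp add: if_distrib if_distribR cong: if_cong)
  finally show ?thesis
    by (simp flip: s)
qed

text \<open>Expanding the square as a double sum over frequencies and summing over \<open>x\<close>
  first kills all off-diagonal terms. The coefficients are arbitrary so that a truncated transform
  is covered too.\<close>

lemma plancherel_synthesis:
  fixes c :: "'n::finite mod_ring \<Rightarrow> complex"
  shows "(\<Sum>x\<in>UNIV. (cmod (\<Sum>m\<in>UNIV. c m * chi (x * m)))\<^sup>2)
    = real CARD('n) * (\<Sum>m\<in>UNIV. (cmod (c m))\<^sup>2)"
proof -
  have "complex_of_real (\<Sum>x\<in>UNIV. (cmod (\<Sum>m\<in>UNIV. c m * chi (x * m)))\<^sup>2)
      = (\<Sum>x\<in>UNIV. \<Sum>m\<in>UNIV. \<Sum>k\<in>UNIV. c m * cnj (c k) * chi ((m - k) * x))"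
    unfolding chi_diff_mult
    by (simp add: complex_norm_square sum_product cnj_chi mult_ac del: of_real_power)
  also have "\<dots> = (\<Sum>m\<in>UNIV. \<Sum>x\<in>UNIV. \<Sum>k\<in>UNIV. c m * cnj (c k) * chi ((m - k) * x))"
    by (rule sum.swap)
  also have "\<dots> = (\<Sum>m\<in>UNIV. \<Sum>k\<in>UNIV. c m * cnj (c k) * (\<Sum>x\<in>UNIV. chi ((m - k) * x)))"
    by (subst sum.swap) (simp add: sum_distrib_left)
  also have "\<dots> = (\<Sum>m\<in>UNIV. c m * cnj (c m) * of_nat CARD('n))"
    unfolding chi_orthogonality by (simp add: if_distrib if_distribR cong: if_cong)
  also have "\<dots> = complex_of_real (real CARD('n) * (\<Sum>m\<in>UNIV. (cmod (c m))\<^sup>2))"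
    by (simp add: complex_norm_square sum_distrib_left mult_ac del: of_real_power)
  finally show ?thesis
    by (simp only: of_real_eq_iff)
qed

lemma lp_norm_1: "lp_norm 1 g = (\<Sum>x\<in>UNIV. cmod (g x))"
  by (simp add: lp_norm_def sum_nonneg)

lemma lp_norm_2: "lp_norm 2 g = sqrt (\<Sum>x\<in>UNIV. (cmod (g x))\<^sup>2)"
  by (simp add: lp_norm_def powr_half_sqrt sum_nonneg)

lemma lp_norm_2_pos: "f \<noteq> (\<lambda>x. 0) \<Longrightarrow> lp_norm 2 f > 0"
  by (auto simp: lp_norm_2 fun_eq_iff intro!: sum_pos2)

lemma lp_norm_2_synthesis:
  fixes c :: "'n::finite mod_ring \<Rightarrow> complex"
  shows "lp_norm 2 (\<lambda>x. 1 / of_real (sqrt (real CARD('n))) * (\<Sum>m\<in>UNIV. c m * chi (x * m)))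
    = lp_norm 2 c"
  by (simp add: lp_norm_2 norm_divide power_divide plancherel_synthesis
      flip: sum_divide_distrib)

lemma plancherel: "lp_norm 2 (fourier f) = lp_norm 2 f"
  using lp_norm_2_synthesis[of "fourier f"] by (simp only: fourier_inversion)

lemma card_large_spectrum_le:
  fixes f :: "'n::finite mod_ring \<Rightarrow> complex"
  assumes "f \<noteq> (\<lambda>x. 0)" and "\<eta> > 0"
  shows "real (card (large_spectrum \<eta> f)) \<le> fourier_ratio f / \<eta> * sqrt (real CARD('n))"
proof -
  let ?\<Gamma> = "large_spectrum \<eta> f"
  have "real (card ?\<Gamma>) * (\<eta> * L2mu_norm f) \<le> (\<Sum>m\<in>?\<Gamma>. cmod (fourier f m))"
    by (rule sum_bounded_below) (simp add: large_spectrum_def)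
  also have "\<dots> \<le> lp_norm 1 (fourier f)"
    unfolding lp_norm_1 by (rule sum_mono2) auto
  finally show ?thesis
    \<comment> \<open>Plancherel turns the denominator of the Fourier ratio into the positive
      \<open>lp_norm 2 f\<close>, which cancels; the factor sqrt N comes from
      \<open>L2mu_norm\<close>.\<close>
    using assms(2) lp_norm_2_pos[OF assms(1)]
    by (simp add: fourier_ratio_def plancherel L2mu_norm_def field_simps)
qed

lemma large_spectrum_approximation:
  fixes f :: "'n::finite mod_ring \<Rightarrow> complex"
  assumes "\<eta> > 0"
  shows "lp_norm 2 (\<lambda>x. f x - 1 / of_real (sqrt (real CARD('n)))
      * (\<Sum>m\<in>large_spectrum \<eta> f. fourier f m * chi (x * m))) \<le> \<eta> * lp_norm 2 f"
proof -
  let ?\<Gamma> = "large_spectrum \<eta> f"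
  let ?s = "complex_of_real (sqrt (real CARD('n)))"
  \<comment> \<open>The Fourier coefficients of the error, extended by zero so that
    \<open>lp_norm_2_synthesis\<close>, which sums over all frequencies, applies.\<close>
  define c where "c = (\<lambda>m. if m \<in> ?\<Gamma> then 0 else fourier f m)"
  have "f x - 1 / ?s * (\<Sum>m\<in>?\<Gamma>. fourier f m * chi (x * m))
      = 1 / ?s * (\<Sum>m\<in>UNIV. c m * chi (x * m))" for x
  proof -
    have "(\<Sum>m\<in>UNIV. c m * chi (x * m)) = (\<Sum>m\<in>- ?\<Gamma>. fourier f m * chi (x * m))"
      by (rule sum.mono_neutral_cong_right) (auto simp: c_def)
    moreover have "(\<Sum>m\<in>UNIV. fourier f m * chi (x * m))
      = (\<Sum>m\<in>?\<Gamma>. fourier f m * chi (x * m)) + (\<Sum>m\<in>- ?\<Gamma>. fourier f m * chi (x * m))"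
      by (subst sum.union_disjoint[symmetric]) (auto simp: Compl_partition)
    ultimately show ?thesis
      unfolding fourier_inversion[of f x, symmetric] by (simp add: add_divide_distrib)
  qed
  then have "lp_norm 2 (\<lambda>x. f x - 1 / ?s * (\<Sum>m\<in>?\<Gamma>. fourier f m * chi (x * m)))
      = lp_norm 2 c"
    by (simp only: lp_norm_2_synthesis)
  also have "\<dots> \<le> \<eta> * lp_norm 2 f"
  proof -
    have nonneg: "0 \<le> \<eta> * lp_norm 2 f"
      using assms by (simp add: lp_norm_def)
    \<comment> \<open>Off \<open>?\<Gamma>\<close> this is the failure of the threshold; on
      \<open>?\<Gamma>\<close> the left side is 0.\<close>
    have "(cmod (c m))\<^sup>2 \<le> (\<eta> * L2mu_norm f)\<^sup>2" for m
      using nonneg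
      by (intro power_mono) (auto simp: c_def large_spectrum_def L2mu_norm_def)
    then have "(\<Sum>m\<in>UNIV. (cmod (c m))\<^sup>2) \<le> real CARD('n) * (\<eta> * L2mu_norm f)\<^sup>2"
      using sum_bounded_above[of UNIV "\<lambda>m. (cmod (c m))\<^sup>2"] by simp
    \<comment> \<open>The N terms cancel the factor 1/N in the square of
      \<open>L2mu_norm f\<close>.\<close>
    also have "\<dots> = (\<eta> * lp_norm 2 f)\<^sup>2"
      by (simp add: L2mu_norm_def power_divide power_mult_distrib)
    finally show ?thesis
      unfolding lp_norm_2[of c] using nonneg by (rule real_le_lsqrt[rotated])
  qed
  finally show ?thesis .
qed

theorem theorem1p37:
  fixes f P :: "'n::finite mod_ring \<Rightarrow> complex"
    and \<eta> :: real
    and \<Gamma> :: "'n mod_ring set"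
  assumes "f \<noteq> (\<lambda>x. 0)"
    and "\<eta> > 0"
    and "\<Gamma> = large_spectrum \<eta> f"
    and "P = (\<lambda>x. 1 / of_real (sqrt (real CARD('n))) * (\<Sum>m\<in>\<Gamma>. fourier f m * chi (x * m)))"
  shows "real (card \<Gamma>) \<le> fourier_ratio f / \<eta> * sqrt (real CARD('n))
    \<and> lp_norm 2 (\<lambda>x. f x - P x) \<le> \<eta> * lp_norm 2 f
    \<and> (\<exists>S c. real (card S) \<le> fourier_ratio f / \<eta> * sqrt (real CARD('n))
          \<and> lp_norm 2 (\<lambda>x. f x - trig_poly S c x) \<le> \<eta> * lp_norm 2 f)"
proof -
  have card: "real (card \<Gamma>) \<le> fourier_ratio f / \<eta> * sqrt (real CARD('n))"
    using card_large_spectrum_le assms by simp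
  have approx: "lp_norm 2 (\<lambda>x. f x - P x) \<le> \<eta> * lp_norm 2 f"
    unfolding assms(3,4) using \<open>\<eta> > 0\<close> by (rule large_spectrum_approximation)
  \<comment> \<open>\<open>trig_poly\<close> has no normalising factor, so 1/sqrt N goes into the
    coefficients; \<open>\<Gamma>\<close> and these coefficients witness the existential
    claim.\<close>
  have "P = trig_poly \<Gamma> (\<lambda>m. 1 / of_real (sqrt (real CARD('n))) * fourier f m)"
    by (simp add: assms(4) trig_poly_def fun_eq_iff sum_divide_distrib)
  with card approx show ?thesis
    by metis
qed

end
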